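(* Let $\theta=(\theta_n)_{n\ge1}$ be an arbitrary sequence of real numbers. For a positive integer $N$ and real $X>0$ define \[R(N,X;\theta):=N^{-1}\#\{(m,n):\ 1\le m<n\le N,\ \|\theta_m-\theta_n\|\le XN^{-1}\}\] and \[R_0(N,X;\theta):=N^{-1}\sum_{m=1}^N\sum_{n=1}^N\left\{1-\frac{\|\theta_m-\theta_n\|}{X/N}\right\}^{+}.\] Then: (i) $\lim_{N\to\infty}R(N,X;\theta)=X$ for all $X>0$ if and only if $\lim_{N\to\infty}R_0(N,X;\theta)=1+X$ for all $X>0$; (ii) $R_0(N,X;\theta)\ge\max(1,X)$ for all $N$ and all $X>0$; (iii) $R_0(N,X+Y;\theta)\le R_0(N,X;\theta)+R_0(N,Y;\theta)$ for all $N$ and all $X,Y>0$.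
   Context: $\|t\|$ denotes the distance from the real number $t$ to the nearest integer, and $\{t\}^{+}=\max(t,0)$. In (i) no uniformity in $X$ is assumed in either limit.
   Formalization: In (ii), the bound R_0 ≥ max(1,X) is false for all X>0 (N=1, X=2 gives R_0=1); it is stated for 0<X≤⌈N/2⌉, the largest range valid for every θ, while R_0 ≥ 1 is kept for all N and all X>0. *)

theory Defs
  imports Complex_Main
begin

definition dist_int :: "real \<Rightarrow> real" where
  "dist_int t = \<bar>t - of_int (round t)\<bar>"

definition pos_part :: "real \<Rightarrow> real" where
  "pos_part t = max t 0"

text \<open>A sequence indexed by the positive integers is a function on \<open>nat\<close> whose
  value at \<open>0\<close> is never used.\<close>

definition R :: "nat \<Rightarrow> real \<Rightarrow> (nat \<Rightarrow> real) \<Rightarrow> real" where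
  "R N X \<theta> = inverse (real N) *
     real (card {(m, n). 1 \<le> m \<and> m < n \<and> n \<le> N \<and> dist_int (\<theta> m - \<theta> n) \<le> X * inverse (real N)})"

definition R0 :: "nat \<Rightarrow> real \<Rightarrow> (nat \<Rightarrow> real) \<Rightarrow> real" where
  "R0 N X \<theta> = inverse (real N) *
     (\<Sum>m=1..N. \<Sum>n=1..N. pos_part (1 - dist_int (\<theta> m - \<theta> n) / (X / real N)))"

text \<open>Since \<open>R0 N X \<theta> \<le> N\<close>, the bound \<open>R0 N X \<theta> \<ge> max 1 X\<close> cannot hold
  for all \<open>X > 0\<close>. The following lemma shows that the range \<open>X \<le> \<lceil>N / 2\<rceil>\<close> is the
  largest on which it can hold for every sequence: beyond it, the bound fails for the sequence
  alternating between \<open>0\<close> and \<open>1/2\<close>.\<close>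

lemma R0_less_beyond_half:
  assumes N: "N \<ge> 1" and X: "X > of_int \<lceil>real N / 2\<rceil>"
  shows "R0 N X (\<lambda>n. if even n then 0 else 1/2) < X"
proof -
  define \<theta> :: "nat \<Rightarrow> real" where "\<theta> = (\<lambda>n. if even n then 0 else 1/2)"
  define a where "a = real (card {n\<in>{1..N}. even n})"
  define b where "b = real (card {n\<in>{1..N}. odd n})"
  have r: "dist_int 0 = 0" "dist_int (1/2) = 1/2" "dist_int (- (1/2)) = 1/2"
    by (simp_all add: dist_int_def round_def)
  have evn: "card {n\<in>{1..N}. even n} = N div 2"
  proof -
    have "{n\<in>{1..N}. even n} = (\<lambda>k. 2 * k) ` {1..N div 2}"
      by (auto elim!: evenE)
    then show ?thesis by (simp add: card_image inj_on_def)
  qed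
  have "card {1..N} = card ({n\<in>{1..N}. even n} \<union> {n\<in>{1..N}. odd n})"
    by (rule arg_cong[where f = card]) auto
  also have "\<dots> = card {n\<in>{1..N}. even n} + card {n\<in>{1..N}. odd n}"
    by (rule card_Un_disjoint) auto
  finally have ab: "a + b = real N"
    unfolding a_def b_def by simp
  have a: "a = real (N div 2)" using evn by (simp add: a_def)
  have c: "real_of_int \<lceil>real N / 2\<rceil> = b"
  proof (cases "even N")
    case True
    then obtain k where "N = 2 * k" by (elim evenE)
    then show ?thesis using a ab by simp
  next
    case False
    then obtain k where k: "N = 2 * k + 1" by (elim oddE)
    have "\<lceil>real N / 2\<rceil> = int k + 1" using k by (intro ceiling_unique) auto
    then show ?thesis using k a ab by simp
  qed
  have X': "X > b" using X c by simp
  have ale: "a \<le> b" using a ab by linarith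
  have a0: "a \<ge> 0" by (simp add: a_def)
  have X0: "X > 0" using X' ale a0 by linarith
  have half: "2 * X > N" using X' ale ab by linarith
  have t: "pos_part (1 - dist_int (\<theta> m - \<theta> n) / (X / real N))
      = (if even m = even n then 1 else 1 - real N / (2 * X))" for m n
    using half X0 N by (auto simp: \<theta>_def r pos_part_def field_simps max_def)
  have inner: "(\<Sum>n=1..N. if even m = even n then 1 else c) =
      (if even m then a + b * c else b + a * c)" for m :: nat and c :: real
  proof -
    have "(\<Sum>n=1..N. if even m = even n then 1 else c) =
       (\<Sum>n\<in>{1..N} \<inter> {n. even m = even n}. 1) + (\<Sum>n\<in>{1..N} \<inter> - {n. even m = even n}. c)"
      by (rule sum.If_cases) simp
    moreover have "{1..N} \<inter> {n. even n} = {n\<in>{1..N}. even n}"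
      "{1..N} \<inter> {n. odd n} = {n\<in>{1..N}. odd n}"
      "{1..N} \<inter> - {n. even n} = {n\<in>{1..N}. odd n}"
      "{1..N} \<inter> - {n. odd n} = {n\<in>{1..N}. even n}" by auto
    ultimately show ?thesis by (cases "even m") (simp_all add: a_def b_def)
  qed
  have outer: "(\<Sum>m=1..N. if even m then c else d) = a * c + b * d" for c d :: real
  proof -
    have "(\<Sum>m=1..N. if even m then c else d) =
       (\<Sum>m\<in>{1..N} \<inter> {m. even m}. c) + (\<Sum>m\<in>{1..N} \<inter> - {m. even m}. d)"
      by (rule sum.If_cases) simp
    moreover have "{1..N} \<inter> {n. even n} = {n\<in>{1..N}. even n}"
      "{1..N} \<inter> - {n. even n} = {n\<in>{1..N}. odd n}" by auto
    ultimately show ?thesis by (simp add: a_def b_def)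
  qed
  let ?c = "1 - real N / (2 * X)"
  have "R0 N X \<theta> = inverse (real N) * (a * (a + b * ?c) + b * (b + a * ?c))"
    unfolding R0_def t inner outer ..
  also have "a * (a + b * ?c) + b * (b + a * ?c) = real N * (real N - a * b / X)"
    using X0 unfolding ab[symmetric] by (simp add: field_simps)
  also have "inverse (real N) * (real N * (real N - a * b / X)) = (a + b) - a * b / X"
    using N ab by simp
  also have "\<dots> < X"
  proof -
    have "(X - a) * (X - b) > 0" using X' ale by simp
    then show ?thesis using X0 by (simp add: field_simps)
  qed
  finally show ?thesis by (simp add: \<theta>_def)
qed

end

theory Submission
  imports Defs "HOL-Analysis.Analysis" "HOL-Real_Asymp.Real_Asymp"
begin

text \<open>
  Put \<open>\<delta> = X / N\<close>. For \<open>\<delta> \<le> 1/2\<close> the tent function \<open>(\<delta> - \<parallel>t\<parallel>)\<^sup>+\<close> is the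
  autocorrelation of the indicator function of an arc of length \<open>\<delta>\<close> on the circle, so that
  \<open>X * R0 N X\<close> is the integral of \<open>f\<^sub>\<delta>\<^sup>2\<close>, where \<open>f\<^sub>\<delta> u\<close> counts the points in
  the arc from \<open>u - \<delta>\<close> to \<open>u\<close>. The lower bound is the Cauchy-Schwarz inequality applied to
  \<open>f\<^sub>\<delta>\<close>, whose integral is \<open>X\<close>. Subadditivity follows by integrating
  \<open>(p + q)\<^sup>2 / (\<delta> + \<epsilon>) \<le> p\<^sup>2 / \<delta> + q\<^sup>2 / \<epsilon>\<close> after cutting an arc of length
  \<open>\<delta> + \<epsilon>\<close> into two. Beyond \<open>\<delta> = 1/2\<close> the dependence on \<open>\<delta>\<close> is explicit.

  For the equivalence of the limits, \<open>X * (R0 N X - 1) / 2\<close> is the primitive of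
  \<open>R N\<close> that vanishes at \<open>0\<close>. As \<open>R N\<close> is increasing, difference quotients of this
  primitive bound \<open>R N\<close> from both sides, and Riemann sums of \<open>R N\<close> bound the primitive.
\<close>

section \<open>Periodic functions and arcs of the circle\<close>

text \<open>Only the fractional part \<open>c\<close> of \<open>- a\<close> matters. Splitting the
  period at \<open>1 - c\<close> gives translates of \<open>{c..1}\<close> and
  \<open>{0..c}\<close>.\<close>

lemma has_integral_shift_periodic:
  fixes g :: "real \<Rightarrow> real"
  assumes g: "(g has_integral I) {0..1}" and per: "\<And>x (k::int). g (x + of_int k) = g x"
  shows "((\<lambda>x. g (x - a)) has_integral I) {0..1}"
proof -
  define c where "c = frac (- a)"
  have c: "0 \<le> c" "c \<le> 1"
    by (simp_all add: c_def frac_ge_0 less_imp_le[OF frac_lt_1])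
  have ga: "g (x - a) = g (x + c)" for x
    using per[of "x + c" "\<lfloor>- a\<rfloor>"] by (simp add: c_def frac_def)
  have int: "g integrable_on {0..c}" "g integrable_on {c..1}"
    using g c by (auto intro: integrable_subinterval_real simp: has_integral_integrable)
  have I: "I = integral {c..1} g + integral {0..c} g"
    using Henstock_Kurzweil_Integration.integral_combine[of 0 c 1 g] c g
    by (simp add: has_integral_integrable integral_unique)
  have 1: "((\<lambda>x. g (x + c)) has_integral integral {c..1} g) {0..1 - c}"
    using has_integral_shift_real_ivl[OF integrable_integral[OF int(2)], of c] by simp
  have "((\<lambda>x. g (x + (c - 1))) has_integral integral {0..c} g) {1 - c..1}"
    using has_integral_shift_real_ivl[OF integrable_integral[OF int(1)], of "c - 1"] by simp
  moreover have "g (x + (c - 1)) = g (x + c)" for x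
    using per[of "x + c" "-1"] by (simp add: algebra_simps)
  ultimately have 2: "((\<lambda>x. g (x + c)) has_integral integral {0..c} g) {1 - c..1}"
    by simp
  show ?thesis
    unfolding ga I using has_integral_combine[OF _ _ 1 2] c by simp
qed

text \<open>The number of integers in \<open>{t - \<delta><..t}\<close>; for \<open>0 \<le> \<delta> \<le> 1\<close> this is
  the indicator function of the arc \<open>[0, \<delta>)\<close> of the circle. In the floor form additivity
  in \<open>\<delta>\<close> is a telescoping identity.\<close>

definition arc_ind :: "real \<Rightarrow> real \<Rightarrow> real" where
  "arc_ind \<delta> t = of_int (\<lfloor>t\<rfloor> - \<lfloor>t - \<delta>\<rfloor>)"

lemma arc_ind_add: "arc_ind (\<delta> + \<epsilon>) t = arc_ind \<delta> t + arc_ind \<epsilon> (t - \<delta>)"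
  by (simp add: arc_ind_def diff_diff_eq)

lemma arc_ind_add_int: "arc_ind \<delta> (t + of_int k) = arc_ind \<delta> t"
proof -
  have "\<lfloor>t + of_int k - \<delta>\<rfloor> = \<lfloor>t - \<delta>\<rfloor> + k"
    by (metis add_diff_eq diff_add_eq floor_add_int)
  then show ?thesis by (simp add: arc_ind_def)
qed

text \<open>The range of \<open>t\<close> covers differences of two points of \<open>[0, 1)\<close>;
  a negative \<open>t\<close> meets the copy of the arc shifted by \<open>- 1\<close>, which is the
  second disjunct.\<close>

lemma arc_ind_eq:
  assumes "0 \<le> \<delta>" "\<delta> \<le> 1" "- 1 \<le> t" "t < 1"
  shows "arc_ind \<delta> t = of_bool (0 \<le> t \<and> t < \<delta> \<or> t + 1 < \<delta>)"
proof -
  have "\<lfloor>t\<rfloor> = (if t < 0 then - 1 else 0)"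
    using assms by (auto intro!: floor_unique)
  moreover have "\<lfloor>t - \<delta>\<rfloor> = (if t - \<delta> < - 1 then - 2 else if t - \<delta> < 0 then - 1 else 0)"
    using assms by (auto intro!: floor_unique)
  ultimately show ?thesis
    using assms by (auto simp: arc_ind_def)
qed

text \<open>Truncating by \<open>pos_part\<close> admits \<open>b < a\<close> as an empty interval,
  so overlaps of arcs can be integrated without deciding whether they are empty.\<close>

lemma has_integral_interval:
  assumes "0 \<le> a" "b \<le> 1"
  shows "((\<lambda>u. if u \<in> {a..b} then 1 else 0) has_integral pos_part (b - a)) {0..1::real}"
proof -
  have "((\<lambda>u. 1::real) has_integral pos_part (b - a)) {a..b}"
    using has_integral_const_real[of "1::real" a b]
    by (cases "a \<le> b") (simp_all add: pos_part_def)
  then show ?thesis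
    using assms by (subst has_integral_restrict) auto
qed

lemma has_integral_arc_ind:
  assumes "0 \<le> \<delta>" "\<delta> \<le> 1"
  shows "((\<lambda>u. arc_ind \<delta> (u - a)) has_integral \<delta>) {0..1}"
proof (rule has_integral_shift_periodic)
  have "((\<lambda>u. if u \<in> {0..\<delta>} then 1 else 0) has_integral \<delta>) {0..1::real}"
    using has_integral_interval[of 0 \<delta>] assms by (simp add: pos_part_def)
  then show "(arc_ind \<delta> has_integral \<delta>) {0..1}"
    by (rule has_integral_spike_finite[of "{0, 1, \<delta>}", rotated 2])
      (use assms in \<open>auto simp: arc_ind_eq\<close>)
qed (rule arc_ind_add_int)

lemma dist_int_nonneg: "0 \<le> dist_int t"
  by (simp add: dist_int_def)

lemma dist_int_le_half: "dist_int t \<le> 1 / 2"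
  using of_int_round_abs_le[of t] by (simp add: dist_int_def abs_minus_commute)

lemma dist_int_minus: "dist_int (- t) = dist_int t"
proof -
  have "dist_int (- s) \<le> dist_int s" for s
    using round_diff_minimal[of "- s" "- round s"] by (simp add: dist_int_def)
  from this[of t] this[of "- t"] show ?thesis by simp
qed

text \<open>For \<open>\<delta> > 1/2\<close> two arcs of length \<open>\<delta>\<close> can also meet on the far side of
  the circle, which gives the second term.\<close>

lemma has_integral_arc_ind_mult:
  assumes "0 \<le> \<delta>" "\<delta> \<le> 1"
  shows "((\<lambda>u. arc_ind \<delta> (u - a) * arc_ind \<delta> (u - b)) has_integral
    pos_part (\<delta> - dist_int (a - b)) + pos_part (\<delta> - (1 - dist_int (a - b)))) {0..1}"
proof -
  \<comment> \<open>Up to an integer and the order of \<open>a\<close> and \<open>b\<close>, the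
    offset of the arcs is \<open>t = dist_int (a - b)\<close>.\<close>
  have *: "((\<lambda>u. arc_ind \<delta> (u - a) * arc_ind \<delta> (u - b)) has_integral
      pos_part (\<delta> - t) + pos_part (\<delta> - (1 - t))) {0..1}"
    if t: "0 \<le> t" "t \<le> 1 / 2" and b: "b = a + t + of_int k" for a b t :: real and k :: int
  proof -
    define g where "g = (\<lambda>u. arc_ind \<delta> u * arc_ind \<delta> (u - t))"
    \<comment> \<open>The arcs \<open>[0, \<delta>)\<close> and \<open>[t, t + \<delta>)\<close>
      meet in \<open>[t, \<delta>)\<close> and, after wrapping around, in
      \<open>[0, \<delta> + t - 1)\<close>.\<close>
    have "((\<lambda>u. (if u \<in> {t..\<delta>} then 1 else 0) + (if u \<in> {0..\<delta> + t - 1} then 1 else 0)) has_integral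
      pos_part (\<delta> - t) + pos_part (\<delta> + t - 1 - 0)) {0..1::real}"
      using t assms by (intro has_integral_add has_integral_interval) auto
    then have "(g has_integral pos_part (\<delta> - t) + pos_part (\<delta> + t - 1 - 0)) {0..1}"
      unfolding g_def
      by (rule has_integral_spike_finite[of "{0, 1, t, \<delta>, \<delta> + t - 1}", rotated 2])
        (use assms t in \<open>auto simp: arc_ind_eq\<close>)
    then have "((\<lambda>u. g (u - a)) has_integral pos_part (\<delta> - t) + pos_part (\<delta> + t - 1 - 0)) {0..1}"
    proof (rule has_integral_shift_periodic)
      fix x and k :: int
      show "g (x + of_int k) = g x"
        using arc_ind_add_int[of \<delta> "x - t" k] by (simp add: g_def arc_ind_add_int algebra_simps)
    qed
    moreover have "g (u - a) = arc_ind \<delta> (u - a) * arc_ind \<delta> (u - b)" for u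
      using arc_ind_add_int[of \<delta> "u - b" k] by (simp add: g_def b algebra_simps)
    ultimately show ?thesis
      by (simp add: algebra_simps)
  qed
  show ?thesis
  proof (cases "a - b - of_int (round (a - b)) \<ge> 0")
    case True
    then have "a = b + dist_int (a - b) + of_int (round (a - b))"
      by (simp add: dist_int_def)
    from *[OF dist_int_nonneg dist_int_le_half this] show ?thesis
      by (simp add: mult.commute)
  next
    case False
    then have "b = a + dist_int (a - b) + of_int (- round (a - b))"
      by (simp add: dist_int_def)
    from *[OF dist_int_nonneg dist_int_le_half this] show ?thesis .
  qed
qed


section \<open>Counting functions and the energy as an integral\<close>

definition arc_count :: "'a set \<Rightarrow> ('a \<Rightarrow> real) \<Rightarrow> real \<Rightarrow> real \<Rightarrow> real" where
  "arc_count A \<theta> \<delta> u = (\<Sum>n\<in>A. arc_ind \<delta> (u - \<theta> n))"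

text \<open>The sum in \<open>R0\<close> with tents of slope 1 instead of height 1, the form in
  which it arises as an integral of squared counts.\<close>

definition energy :: "'a set \<Rightarrow> ('a \<Rightarrow> real) \<Rightarrow> real \<Rightarrow> real" where
  "energy A \<theta> \<delta> = (\<Sum>m\<in>A. \<Sum>n\<in>A. pos_part (\<delta> - dist_int (\<theta> m - \<theta> n)))"

lemma energy_translate: "energy A (\<lambda>n. \<theta> n + c) \<delta> = energy A \<theta> \<delta>"
  by (simp add: energy_def)

text \<open>The second arc begins where the first ends. Its shift is moved onto the points, where
  \<open>energy_translate\<close> later removes it.\<close>

lemma arc_count_add: "arc_count A \<theta> (\<delta> + \<epsilon>) u = arc_count A \<theta> \<delta> u + arc_count A (\<lambda>n. \<theta> n + \<delta>) \<epsilon> u"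
  by (simp add: arc_count_def arc_ind_add sum.distrib diff_diff_eq)

lemma arc_count_Ints: "arc_count A \<theta> \<delta> u \<in> \<int>"
  by (auto simp: arc_count_def arc_ind_def simp del: of_int_diff intro!: Ints_sum)

lemma has_integral_arc_count:
  fixes \<delta> :: real
  assumes "finite A" "0 \<le> \<delta>" "\<delta> \<le> 1"
  shows "(arc_count A \<theta> \<delta> has_integral card A * \<delta>) {0..1}"
proof -
  have "((\<lambda>u. \<Sum>n\<in>A. arc_ind \<delta> (u - \<theta> n)) has_integral (\<Sum>n\<in>A. \<delta>)) {0..1}"
    using assms by (intro has_integral_sum has_integral_arc_ind)
  then show ?thesis
    by (simp add: arc_count_def[abs_def])
qed

lemma has_integral_arc_count_sq:
  fixes \<delta> :: real
  assumes "finite A" "0 \<le> \<delta>" "\<delta> \<le> 1"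
  shows "((\<lambda>u. (arc_count A \<theta> \<delta> u)\<^sup>2) has_integral
    energy A \<theta> \<delta> + (\<Sum>m\<in>A. \<Sum>n\<in>A. pos_part (\<delta> - (1 - dist_int (\<theta> m - \<theta> n))))) {0..1}"
proof -
  have "((\<lambda>u. \<Sum>m\<in>A. \<Sum>n\<in>A. arc_ind \<delta> (u - \<theta> m) * arc_ind \<delta> (u - \<theta> n)) has_integral
    (\<Sum>m\<in>A. \<Sum>n\<in>A. pos_part (\<delta> - dist_int (\<theta> m - \<theta> n))
      + pos_part (\<delta> - (1 - dist_int (\<theta> m - \<theta> n))))) {0..1}"
    using assms by (intro has_integral_sum has_integral_arc_ind_mult)
  then show ?thesis
    by (simp add: arc_count_def power2_eq_square sum_product energy_def sum.distrib)
qed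

lemma has_integral_arc_count_sq_half:
  fixes \<delta> :: real
  assumes "finite A" "0 \<le> \<delta>" "\<delta> \<le> 1 / 2"
  shows "((\<lambda>u. (arc_count A \<theta> \<delta> u)\<^sup>2) has_integral energy A \<theta> \<delta>) {0..1}"
proof -
  have "pos_part (\<delta> - (1 - dist_int t)) = 0" for t
    using dist_int_le_half[of t] assms by (simp add: pos_part_def)
  then show ?thesis
    using has_integral_arc_count_sq[of A \<delta> \<theta>] assms by simp
qed

section \<open>Lower bounds for the energy, and its form beyond 1/2\<close>

lemma energy_ge_sq:
  fixes \<delta> :: real
  assumes "finite A" "0 \<le> \<delta>" "\<delta> \<le> 1 / 2"
  shows "energy A \<theta> \<delta> \<ge> (card A * \<delta>)\<^sup>2"
proof -
  define c where "c = card A * \<delta>"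
  \<comment> \<open>Cauchy-Schwarz by integrating a tangent to the parabola: \<open>c\<close> is the
    mean of the count, so the tangent at \<open>c\<close> has integral
    \<open>c\<^sup>2\<close>.\<close>
  have "((\<lambda>u. 2 * c * arc_count A \<theta> \<delta> u - c\<^sup>2) has_integral 2 * c * (card A * \<delta>) - c\<^sup>2) {0..1}"
    using assms has_integral_const_real[of "c\<^sup>2" 0 1]
    by (intro has_integral_diff has_integral_mult_right has_integral_arc_count) auto
  note le = has_integral_le[OF this has_integral_arc_count_sq_half[of A \<delta> \<theta>]]
  have "2 * c * (card A * \<delta>) - c\<^sup>2 \<le> energy A \<theta> \<delta>"
  proof (rule le)
    fix u
    show "2 * c * arc_count A \<theta> \<delta> u - c\<^sup>2 \<le> (arc_count A \<theta> \<delta> u)\<^sup>2"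
      using zero_le_power2[of "arc_count A \<theta> \<delta> u - c"] by (simp add: power2_diff mult_ac)
  qed (use assms in auto)
  then show ?thesis by (simp add: c_def power2_eq_square algebra_simps)
qed

text \<open>The mean of the counting function of half circles is \<open>card A / 2\<close>. If \<open>card A\<close>
  is odd, integrality keeps the counts away from this mean and improves the previous bound.\<close>

lemma energy_half_ge_odd:
  assumes "finite A" "odd (card A)"
  shows "energy A \<theta> (1 / 2) \<ge> ((card A)\<^sup>2 + 1) / 4"
proof -
  obtain k where k: "card A = 2 * k + 1" using assms by (elim oddE)
  \<comment> \<open>The chord of the parabola between \<open>k\<close> and \<open>k + 1\<close>, the
    integers next to the mean \<open>k + 1 / 2\<close>, lies above it only strictly between
    them.\<close>
  have le: "(2 * k + 1) * x - k * (k + 1) \<le> x\<^sup>2" if x: "x \<in> \<int>" for x :: real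
  proof -
    obtain z where z: "x = of_int z" using x by (elim Ints_cases)
    have "(z - int k) * (z - int k - 1) \<ge> 0"
      by (cases "z \<le> int k") (auto intro: mult_nonpos_nonpos mult_nonneg_nonneg)
    then have "real_of_int ((z - int k) * (z - int k - 1)) \<ge> 0"
      by (simp only: of_int_0_le_iff)
    then show ?thesis
      by (simp add: z power2_eq_square algebra_simps)
  qed
  have "((\<lambda>u. (2 * k + 1) * arc_count A \<theta> (1 / 2) u - k * (k + 1)) has_integral
      (2 * k + 1) * (card A * (1 / 2)) - k * (k + 1)) {0..1}"
    using assms has_integral_const_real[of "real (k * (k + 1))" 0 1]
    by (intro has_integral_diff has_integral_mult_right has_integral_arc_count) auto
  from has_integral_le[OF this has_integral_arc_count_sq_half[of A "1 / 2" \<theta>]]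
  have "(2 * k + 1) * (card A * (1 / 2)) - k * (k + 1) \<le> energy A \<theta> (1 / 2)"
    using assms le[OF arc_count_Ints] by fastforce
  then show ?thesis by (simp add: k power2_eq_square field_simps)
qed

lemma energy_eq_beyond_half:
  assumes "\<delta> \<ge> 1 / 2"
  shows "energy A \<theta> \<delta> = (card A)\<^sup>2 * (\<delta> - 1 / 2) + energy A \<theta> (1 / 2)"
proof -
  have "pos_part (\<delta> - dist_int t) = \<delta> - 1 / 2 + pos_part (1 / 2 - dist_int t)" for t
    using dist_int_le_half[of t] assms by (simp add: pos_part_def)
  then show ?thesis
    by (simp add: energy_def sum.distrib power2_eq_square)
qed

section \<open>Subadditivity of the energy divided by the arc length\<close>

lemma power2_add_div_le:
  fixes a b :: real
  assumes "a > 0" "b > 0"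
  shows "(x + y)\<^sup>2 / (a + b) \<le> x\<^sup>2 / a + y\<^sup>2 / b"
proof -
  have "x\<^sup>2 / a + y\<^sup>2 / b - (x + y)\<^sup>2 / (a + b) = (b * x - a * y)\<^sup>2 / (a * b * (a + b))"
    using assms by (simp add: divide_simps add_pos_pos less_imp_neq[symmetric])
      (simp add: power2_eq_square algebra_simps)
  also have "\<dots> \<ge> 0" using assms by simp
  finally show ?thesis by simp
qed

lemma energy_subadditive_le_half:
  assumes "finite A" and \<delta>: "0 < \<delta>" "\<delta> \<le> 1 / 2" and \<epsilon>: "0 < \<epsilon>" "\<epsilon> \<le> 1 / 2"
  shows "energy A \<theta> (\<delta> + \<epsilon>) / (\<delta> + \<epsilon>) \<le> energy A \<theta> \<delta> / \<delta> + energy A \<theta> \<epsilon> / \<epsilon>"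
proof -
  let ?E = "\<Sum>m\<in>A. \<Sum>n\<in>A. pos_part (\<delta> + \<epsilon> - (1 - dist_int (\<theta> m - \<theta> n)))"
  let ?\<theta> = "\<lambda>n. \<theta> n + \<delta>"
  \<comment> \<open>\<open>\<delta> + \<epsilon>\<close> may exceed 1/2, so the squared count also
    carries the far-side overlaps \<open>?E\<close>; they only enlarge the left-hand side.\<close>
  have "?E \<ge> 0"
    by (intro sum_nonneg) (simp add: pos_part_def)
  then have "energy A \<theta> (\<delta> + \<epsilon>) / (\<delta> + \<epsilon>) \<le> (energy A \<theta> (\<delta> + \<epsilon>) + ?E) / (\<delta> + \<epsilon>)"
    using assms by (simp add: divide_right_mono)
  also have "\<dots> \<le> energy A \<theta> \<delta> / \<delta> + energy A ?\<theta> \<epsilon> / \<epsilon>"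
  proof (rule has_integral_le)
    show "((\<lambda>u. (arc_count A \<theta> (\<delta> + \<epsilon>) u)\<^sup>2 / (\<delta> + \<epsilon>)) has_integral
        (energy A \<theta> (\<delta> + \<epsilon>) + ?E) / (\<delta> + \<epsilon>)) {0..1}"
      using assms by (intro has_integral_divide has_integral_arc_count_sq) auto
    show "((\<lambda>u. (arc_count A \<theta> \<delta> u)\<^sup>2 / \<delta> + (arc_count A ?\<theta> \<epsilon> u)\<^sup>2 / \<epsilon>) has_integral
        energy A \<theta> \<delta> / \<delta> + energy A ?\<theta> \<epsilon> / \<epsilon>) {0..1}"
      using assms by (intro has_integral_add has_integral_divide has_integral_arc_count_sq_half) auto
  qed (simp add: arc_count_add power2_add_div_le \<delta> \<epsilon>)
  finally show ?thesis by (simp add: energy_translate)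
qed

text \<open>For \<open>x \<ge> 1 / 2\<close> the quotient \<open>energy A \<theta> x / x\<close> is
  \<open>c - S / x\<close> with \<open>S \<le> c / 4\<close>. Its growth from
  \<open>\<delta>\<close> to \<open>\<delta> + \<epsilon>\<close> is
  \<open>S * (\<epsilon> / (\<delta> * (\<delta> + \<epsilon>)))\<close>, which the term at
  \<open>\<epsilon>\<close> must absorb.\<close>

lemma energy_subadditive_ge_half:
  assumes "finite A" and \<delta>: "\<delta> \<ge> 1 / 2" and \<epsilon>: "0 < \<epsilon>"
  shows "energy A \<theta> (\<delta> + \<epsilon>) / (\<delta> + \<epsilon>) \<le> energy A \<theta> \<delta> / \<delta> + energy A \<theta> \<epsilon> / \<epsilon>"
proof -
  define c where "c = (real (card A))\<^sup>2"
  define S where "S = c / 2 - energy A \<theta> (1 / 2)"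
  have E: "energy A \<theta> x = c * x - S" if "x \<ge> 1 / 2" for x
    using energy_eq_beyond_half[OF that, of A \<theta>] by (simp add: S_def c_def algebra_simps)
  have S: "S \<le> c / 4"
    using energy_ge_sq[of A "1 / 2" \<theta>] assms by (simp add: S_def c_def power_mult_distrib power2_eq_square)
  have c0: "c \<ge> 0" by (simp add: c_def)
  have "c / 4 * (\<epsilon> / (\<delta> * (\<delta> + \<epsilon>))) \<le> energy A \<theta> \<epsilon> / \<epsilon>"
  proof (cases "\<epsilon> \<ge> 1 / 2")
    case True
    \<comment> \<open>Both sides are compared with \<open>c / 2\<close>; on the right,
      \<open>c - c / (4 * \<epsilon>)\<close> is at least this since
      \<open>\<epsilon> \<ge> 1 / 2\<close>.\<close>
    have "\<epsilon> / (\<delta> * (\<delta> + \<epsilon>)) \<le> 2"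
      using \<delta> \<epsilon> mult_mono[of "1/2" \<delta> \<epsilon> "\<delta> + \<epsilon>"] by (simp add: divide_simps)
    then have "c / 4 * (\<epsilon> / (\<delta> * (\<delta> + \<epsilon>))) \<le> c / 4 * 2"
      using c0 by (intro mult_left_mono) auto
    also have "c / 4 * 2 \<le> (c * \<epsilon> - c / 4) / \<epsilon>"
      using True c0 mult_left_mono[of "1/2" \<epsilon> c] by (simp add: field_simps)
    also have "\<dots> \<le> energy A \<theta> \<epsilon> / \<epsilon>"
      using S True by (simp add: E divide_right_mono)
    finally show ?thesis .
  next
    case False
    \<comment> \<open>Now the left side is at most \<open>c * \<epsilon>\<close>, which is the
      Cauchy-Schwarz bound divided by \<open>\<epsilon>\<close>.\<close>
    have "1 / 2 * (1 / 2) \<le> \<delta> * (\<delta> + \<epsilon>)"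
      using \<delta> \<epsilon> by (intro mult_mono) auto
    then have "\<epsilon> / (\<delta> * (\<delta> + \<epsilon>)) \<le> \<epsilon> / (1 / 4)"
      using \<epsilon> by (intro divide_left_mono) auto
    then have "c / 4 * (\<epsilon> / (\<delta> * (\<delta> + \<epsilon>))) \<le> c / 4 * (\<epsilon> / (1 / 4))"
      using c0 by (intro mult_left_mono) auto
    also have "\<dots> = (card A * \<epsilon>)\<^sup>2 / \<epsilon>"
      using \<epsilon> by (simp add: c_def power2_eq_square)
    also have "\<dots> \<le> energy A \<theta> \<epsilon> / \<epsilon>"
      using energy_ge_sq[of A \<epsilon> \<theta>] assms False by (intro divide_right_mono) auto
    finally show ?thesis .
  qed
  moreover have "S * (\<epsilon> / (\<delta> * (\<delta> + \<epsilon>))) \<le> c / 4 * (\<epsilon> / (\<delta> * (\<delta> + \<epsilon>)))"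
    using S \<delta> \<epsilon> by (intro mult_right_mono) auto
  moreover have "energy A \<theta> (\<delta> + \<epsilon>) / (\<delta> + \<epsilon>) = energy A \<theta> \<delta> / \<delta> + S * (\<epsilon> / (\<delta> * (\<delta> + \<epsilon>)))"
    using \<delta> \<epsilon> by (simp add: E divide_simps add_pos_pos less_imp_neq[symmetric]) (simp add: algebra_simps)
  ultimately show ?thesis by simp
qed

lemma energy_subadditive:
  assumes "finite A" "0 < \<delta>" "0 < \<epsilon>"
  shows "energy A \<theta> (\<delta> + \<epsilon>) / (\<delta> + \<epsilon>) \<le> energy A \<theta> \<delta> / \<delta> + energy A \<theta> \<epsilon> / \<epsilon>"
  using energy_subadditive_le_half[of A \<delta> \<epsilon> \<theta>] energy_subadditive_ge_half[of A \<delta> \<epsilon> \<theta>]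
    energy_subadditive_ge_half[of A \<epsilon> \<delta> \<theta>] assms
  by (cases "\<delta> \<le> 1 / 2"; cases "\<epsilon> \<le> 1 / 2") (simp_all add: add.commute)

section \<open>Lower bounds and subadditivity for \<open>R0\<close>\<close>

lemma R0_eq_energy:
  assumes "X > 0" "N \<ge> 1"
  shows "R0 N X \<theta> = inverse N * (energy {1..N} \<theta> (X / N) / (X / N))"
proof -
  have "pos_part (1 - d / (X / N)) = pos_part (X / N - d) / (X / N)" for d
    using assms by (simp add: pos_part_def max_def field_simps)
  then show ?thesis
    by (simp only: R0_def energy_def sum_divide_distrib)
qed

lemma R0_ge_1:
  assumes "X > 0" "N \<ge> 1"
  shows "R0 N X \<theta> \<ge> 1"
proof -
  let ?f = "\<lambda>m n. pos_part (1 - dist_int (\<theta> m - \<theta> n) / (X / real N))"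
  have "1 \<le> (\<Sum>n=1..N. ?f m n)" if "m \<in> {1..N}" for m
  proof -
    have "?f m m = 1" by (simp add: pos_part_def dist_int_def)
    moreover have "?f m m \<le> (\<Sum>n=1..N. ?f m n)"
      using that by (intro member_le_sum) (auto simp: pos_part_def)
    ultimately show ?thesis by simp
  qed
  then have "(\<Sum>m=1..N. 1) \<le> (\<Sum>m=1..N. \<Sum>n=1..N. ?f m n)"
    by (intro sum_mono)
  then show ?thesis
    using assms by (simp add: R0_def field_simps)
qed

text \<open>As \<open>R0 N X \<theta>\<close> is the energy divided by \<open>X\<close>, the energy
  must reach \<open>X\<^sup>2\<close>. Up to \<open>N / 2\<close> this is Cauchy-Schwarz; the
  ceiling goes further only for odd \<open>N\<close>, where the sharper bound at 1/2 is extended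
  linearly.\<close>

lemma R0_ge:
  assumes X: "X > 0" "X \<le> of_int \<lceil>real N / 2\<rceil>" and N: "N \<ge> 1"
  shows "R0 N X \<theta> \<ge> X"
proof -
  have "X\<^sup>2 \<le> energy {1..N} \<theta> (X / N)"
  proof (cases "X \<le> N / 2")
    case True
    then show ?thesis
      using energy_ge_sq[of "{1..N}" "X / N" \<theta>] X N by (simp add: field_simps)
  next
    case False
    have "odd N"
    proof
      assume "even N"
      then show False using False X by (auto elim: evenE)
    qed
    then have E: "energy {1..N} \<theta> (1 / 2) \<ge> ((real N)\<^sup>2 + 1) / 4"
      using energy_half_ge_odd[of "{1..N}" \<theta>] by simp
    have "\<lceil>real N / 2\<rceil> \<le> (int N + 1) div 2"
      by (simp add: ceiling_le_iff real_of_int_div \<open>odd N\<close>)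
    then have "real_of_int \<lceil>real N / 2\<rceil> \<le> (real N + 1) / 2"
      using \<open>odd N\<close> by (auto elim!: oddE)
    \<comment> \<open>The bound available equals
      \<open>X\<^sup>2 - (X - N / 2)\<^sup>2 + 1 / 4\<close>, so it suffices that \<open>X\<close>
      exceeds \<open>N / 2\<close> by at most 1/2.\<close>
    then have "(X - N / 2)\<^sup>2 \<le> (1 / 2)\<^sup>2"
      using False X by (intro power_mono) (auto simp: field_simps)
    then have "X\<^sup>2 \<le> N * X - (real N)\<^sup>2 / 2 + ((real N)\<^sup>2 + 1) / 4"
      by (simp add: power2_eq_square field_simps)
    also have "N * X - (real N)\<^sup>2 / 2 = (real N)\<^sup>2 * (X / N - 1 / 2)"
      using N by (simp add: power2_eq_square field_simps)
    also have "\<dots> + ((real N)\<^sup>2 + 1) / 4 \<le> \<dots> + energy {1..N} \<theta> (1 / 2)"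
      using E by simp
    also have "\<dots> = energy {1..N} \<theta> (X / N)"
      using energy_eq_beyond_half[of "X / N" "{1..N}" \<theta>] False N by (simp add: field_simps)
    finally show ?thesis .
  qed
  then have "X\<^sup>2 / X \<le> energy {1..N} \<theta> (X / N) / X"
    using X by (intro divide_right_mono) auto
  then show ?thesis
    using X N by (simp add: R0_eq_energy power2_eq_square field_simps)
qed

lemma R0_subadditive:
  assumes "X > 0" "Y > 0" "N \<ge> 1"
  shows "R0 N (X + Y) \<theta> \<le> R0 N X \<theta> + R0 N Y \<theta>"
proof -
  have "inverse (real N) * (energy {1..N} \<theta> (X / N + Y / N) / (X / N + Y / N))
      \<le> inverse (real N) * (energy {1..N} \<theta> (X / N) / (X / N) + energy {1..N} \<theta> (Y / N) / (Y / N))"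
    using assms by (intro mult_left_mono energy_subadditive) auto
  then show ?thesis
    using assms by (simp add: R0_eq_energy add_divide_distrib distrib_left)
qed

section \<open>Limits of increasing functions and of their primitives\<close>

text \<open>The hypothesis says that \<open>H N\<close> behaves like an antiderivative of the increasing
  function \<open>F N\<close>.\<close>

lemma tendsto_iff_primitive_tendsto:
  fixes F H :: "nat \<Rightarrow> real \<Rightarrow> real"
  assumes H0: "\<And>N. H N 0 = 0" and F0: "\<And>N. F N 0 \<ge> 0"
    and lower: "\<And>N x y. 0 \<le> x \<Longrightarrow> x < y \<Longrightarrow> (y - x) * F N x \<le> H N y - H N x"
    and upper: "\<And>N x y. 0 \<le> x \<Longrightarrow> x < y \<Longrightarrow> H N y - H N x \<le> (y - x) * F N y"
  shows "(\<forall>x>0. (\<lambda>N. F N x) \<longlonglongrightarrow> x) \<longleftrightarrow> (\<forall>x>0. (\<lambda>N. H N x) \<longlonglongrightarrow> x\<^sup>2 / 2)"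
proof (intro iffI allI impI)
  fix x :: real
  assume F: "\<forall>x>0. (\<lambda>N. F N x) \<longlonglongrightarrow> x" and x: "x > 0"
  define s where "s K j = real j * (x / Suc K)" for K j
  have s_last: "s K (Suc K) = x" for K
    by (simp only: s_def) simp
  have s: "s K 0 = 0" "s K (Suc j) - s K j = x / Suc K" "0 \<le> s K j"
    "s K j < s K (Suc j)" for K j
    using x by (auto simp: s_def divide_strict_right_mono add_divide_distrib[symmetric]
        diff_divide_distrib[symmetric] distrib_right)
  have tel: "H N x = (\<Sum>j<Suc K. H N (s K (Suc j)) - H N (s K j))" for N K
    by (subst sum_lessThan_telescope) (simp only: s s_last H0 diff_zero)
  have up: "H N x \<le> (\<Sum>j<Suc K. x / Suc K * F N (s K (Suc j)))" for N K
    unfolding tel[of N K] using upper s by (intro sum_mono) metis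
  \<comment> \<open>The left Riemann sum has a node at 0, where no limit of \<open>F\<close> is
    given; dropping that nonnegative term leaves only positive nodes.\<close>
  have lo: "H N x \<ge> (\<Sum>j<K. x / Suc K * F N (s K (Suc j)))" for N K
  proof -
    have "(\<Sum>j<Suc K. x / Suc K * F N (s K j)) \<le> H N x"
      unfolding tel[of N K] using lower s by (intro sum_mono) metis
    moreover have "x / Suc K * F N (s K 0) \<ge> 0"
      using x F0 by (simp add: s)
    ultimately show ?thesis
      by (simp only: sum.lessThan_Suc_shift)
  qed
  have gauss: "(\<Sum>j<n. x / Suc K * s K (Suc j)) = (x / Suc K)\<^sup>2 * (real n * (real n + 1)) / 2" for n K
  proof -
    have "(\<Sum>j<n. q * (real (Suc j) * q)) = q\<^sup>2 * (real n * (real n + 1)) / 2" for q :: real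
      by (induction n) (simp_all add: field_simps power2_eq_square)
    then show ?thesis unfolding s_def .
  qed
  have lim: "(\<lambda>N. \<Sum>j<n. x / Suc K * F N (s K (Suc j))) \<longlonglongrightarrow>
      (x / Suc K)\<^sup>2 * (real n * (real n + 1)) / 2" for n K
    unfolding gauss[symmetric] using F x
    by (intro tendsto_sum tendsto_mult_left) (simp add: s_def)
  show "(\<lambda>N. H N x) \<longlonglongrightarrow> x\<^sup>2 / 2"
  \<comment> \<open>\<open>K\<close> is fixed before \<open>N\<close> grows, so only limits at
    finitely many nodes enter.\<close>
  proof (rule order_tendstoI)
    fix a assume a: "a < x\<^sup>2 / 2"
    have "(\<lambda>K. (x / Suc K)\<^sup>2 * (real K * (real K + 1)) / 2) \<longlonglongrightarrow> x\<^sup>2 / 2"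
      using x by real_asymp
    from order_tendstoD(1)[OF this a] obtain K where
      "a < (x / Suc K)\<^sup>2 * (real K * (real K + 1)) / 2"
      by (auto dest: eventually_happens)
    from order_tendstoD(1)[OF lim this] show "\<forall>\<^sub>F N in sequentially. a < H N x"
      by eventually_elim (use lo in \<open>blast intro: less_le_trans\<close>)
  next
    fix a assume a: "a > x\<^sup>2 / 2"
    have "(\<lambda>K. (x / Suc K)\<^sup>2 * (real (Suc K) * (real (Suc K) + 1)) / 2) \<longlonglongrightarrow> x\<^sup>2 / 2"
      using x by real_asymp
    from order_tendstoD(2)[OF this a] obtain K where
      "(x / Suc K)\<^sup>2 * (real (Suc K) * (real (Suc K) + 1)) / 2 < a"
      by (auto dest: eventually_happens)
    from order_tendstoD(2)[OF lim this] show "\<forall>\<^sub>F N in sequentially. H N x < a"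
      by eventually_elim (use up in \<open>blast intro: le_less_trans\<close>)
  qed
next
  fix x :: real
  assume H: "\<forall>x>0. (\<lambda>N. H N x) \<longlonglongrightarrow> x\<^sup>2 / 2" and x: "x > 0"
  have lim: "(\<lambda>N. (H N b - H N a) / (b - a)) \<longlonglongrightarrow> (a + b) / 2" if "0 < a" "a < b" for a b
  proof -
    have "(b\<^sup>2 / 2 - a\<^sup>2 / 2) / (b - a) = (a + b) / 2"
      using that by (simp add: field_simps power2_eq_square)
    moreover have "(\<lambda>N. (H N b - H N a) / (b - a)) \<longlonglongrightarrow> (b\<^sup>2 / 2 - a\<^sup>2 / 2) / (b - a)"
      using H that by (intro tendsto_intros) auto
    ultimately show ?thesis by (simp only:)
  qed
  show "(\<lambda>N. F N x) \<longlonglongrightarrow> x"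
  proof (rule order_tendstoI)
    fix a assume "a < x"
    \<comment> \<open>The quotient over \<open>[y, x]\<close> tends to the midpoint, which exceeds
      \<open>a\<close> as \<open>a \<le> y\<close>; the maximum with \<open>x / 2\<close> keeps
      \<open>y\<close> positive.\<close>
    define y where "y = max a (x / 2)"
    have y: "0 < y" "y < x" "a \<le> y" using x \<open>a < x\<close> by (auto simp: y_def)
    then have "a < (y + x) / 2" by simp
    from order_tendstoD(1)[OF lim[OF y(1,2)] this] show "\<forall>\<^sub>F N in sequentially. a < F N x"
    proof eventually_elim
      case (elim N)
      have "(H N x - H N y) / (x - y) \<le> F N x"
        using upper[of y x N] y by (simp add: divide_le_eq mult.commute)
      with elim show ?case by simp
    qed
  next
    fix a assume "x < a"
    then have "(x + a) / 2 < a" by simp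
    from order_tendstoD(2)[OF lim[OF x \<open>x < a\<close>] this] show "\<forall>\<^sub>F N in sequentially. F N x < a"
    proof eventually_elim
      case (elim N)
      have "F N x \<le> (H N a - H N x) / (a - x)"
        using lower[of x a N] x \<open>x < a\<close> by (simp add: le_divide_eq mult.commute)
      with elim show ?case by simp
    qed
  qed
qed

section \<open>Equivalence of the limits of \<open>R\<close> and \<open>R0\<close>\<close>

lemma sum_square_symmetric:
  fixes f :: "nat \<Rightarrow> nat \<Rightarrow> real"
  assumes "\<And>m n. f m n = f n m"
  shows "(\<Sum>m=1..N. \<Sum>n=1..N. f m n) =
    (\<Sum>m=1..N. f m m) + 2 * (\<Sum>(m, n)\<in>{(m, n). 1 \<le> m \<and> m < n \<and> n \<le> N}. f m n)"
proof -
  let ?L = "{(m, n). 1 \<le> m \<and> m < n \<and> n \<le> N}"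
  let ?U = "{(m, n). 1 \<le> n \<and> n < m \<and> m \<le> N}"
  let ?D = "(\<lambda>m. (m, m)) ` {1..N}"
  have fin: "finite ?L" "finite ?U"
    by (rule finite_subset[of _ "{1..N} \<times> {1..N}"]; auto)+
  have "(\<Sum>m=1..N. \<Sum>n=1..N. f m n) = (\<Sum>(m, n)\<in>{1..N} \<times> {1..N}. f m n)"
    by (rule sum.cartesian_product)
  also have "{1..N} \<times> {1..N} = ?D \<union> (?L \<union> ?U)" by auto
  also have "(\<Sum>(m, n)\<in>?D \<union> (?L \<union> ?U). f m n) =
      (\<Sum>(m, n)\<in>?D. f m n) + ((\<Sum>(m, n)\<in>?L. f m n) + (\<Sum>(m, n)\<in>?U. f m n))"
    using fin by (subst sum.union_disjoint, simp, simp, force, subst sum.union_disjoint) auto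
  also have "(\<Sum>(m, n)\<in>?D. f m n) = (\<Sum>m=1..N. f m m)"
    by (simp add: sum.reindex inj_on_def)
  also have "(\<Sum>(m, n)\<in>?U. f m n) = (\<Sum>(m, n)\<in>?L. f m n)"
    by (rule sum.reindex_bij_witness[of _ prod.swap prod.swap]) (auto simp: assms)
  finally show ?thesis by simp
qed

lemma R_tendsto_iff_R0_tendsto:
  "(\<forall>X>0. (\<lambda>N. R N X \<theta>) \<longlonglongrightarrow> X) \<longleftrightarrow> (\<forall>X>0. (\<lambda>N. R0 N X \<theta>) \<longlonglongrightarrow> 1 + X)"
proof -
  define P where "P N = {(m, n). 1 \<le> m \<and> m < n \<and> n \<le> N}" for N :: nat
  \<comment> \<open>Scaling distances by \<open>N\<close> makes each summand of \<open>H\<close> a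
    ramp of slope 1 in \<open>x\<close> starting at \<open>d N p\<close>, whose derivative is the
    indicator counted by \<open>R\<close>.\<close>
  define d where "d N p = real N * dist_int (\<theta> (fst p) - \<theta> (snd p))" for N and p :: "nat \<times> nat"
  define H where "H N x = inverse (real N) * (\<Sum>p\<in>P N. pos_part (x - d N p))" for N x
  have fin: "finite (P N)" for N
    by (rule finite_subset[of _ "{1..N} \<times> {1..N}"]) (auto simp: P_def)
  have R: "R N x \<theta> = inverse (real N) * (\<Sum>p\<in>P N. of_bool (d N p \<le> x))" for N x
  \<comment> \<open>For \<open>N = 0\<close> both sides vanish because
    \<open>inverse 0 = 0\<close>.\<close>
  proof (cases "N = 0")
    case False
    then have "{(m, n). 1 \<le> m \<and> m < n \<and> n \<le> N \<and> dist_int (\<theta> m - \<theta> n) \<le> x * inverse (real N)}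
        = P N \<inter> {p. d N p \<le> x}"
      by (auto simp: P_def d_def field_simps)
    then show ?thesis
      using fin by (simp add: R_def sum.If_cases of_bool_def)
  qed (simp add: R_def)
  have diff: "H N y - H N x = inverse (real N) * 
      (\<Sum>p\<in>P N. pos_part (y - d N p) - pos_part (x - d N p))" for N x y
    by (simp add: H_def sum_subtractf right_diff_distrib)
  have "(\<forall>X>0. (\<lambda>N. R N X \<theta>) \<longlonglongrightarrow> X) \<longleftrightarrow> (\<forall>x>0. (\<lambda>N. H N x) \<longlonglongrightarrow> x\<^sup>2 / 2)"
  proof (rule tendsto_iff_primitive_tendsto)
    fix N :: nat and x y :: real
    assume xy: "0 \<le> x" "x < y"
    have "(y - x) * R N x \<theta> = inverse (real N) * (\<Sum>p\<in>P N. (y - x) * of_bool (d N p \<le> x))"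
      by (simp add: R sum_distrib_left mult_ac)
    also have "\<dots> \<le> H N y - H N x"
      unfolding diff using xy by (intro mult_left_mono sum_mono) (auto simp: pos_part_def)
    finally show "(y - x) * R N x \<theta> \<le> H N y - H N x" .
    have "H N y - H N x \<le> inverse (real N) * (\<Sum>p\<in>P N. (y - x) * of_bool (d N p \<le> y))"
      unfolding diff using xy by (intro mult_left_mono sum_mono) (auto simp: pos_part_def)
    also have "\<dots> = (y - x) * R N y \<theta>"
      by (simp add: R sum_distrib_left mult_ac)
    finally show "H N y - H N x \<le> (y - x) * R N y \<theta>" .
  next
    show "H N 0 = 0" for N
      by (simp add: H_def pos_part_def d_def dist_int_nonneg)
    show "0 \<le> R N 0 \<theta>" for N
      by (simp add: R_def)
  qed
  also have "\<dots> \<longleftrightarrow> (\<forall>x>0. (\<lambda>N. R0 N x \<theta>) \<longlonglongrightarrow> 1 + x)"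
  proof -
    have R0: "R0 N x \<theta> = 1 + 2 / x * H N x" if x: "x > 0" and N: "N \<ge> 1" for x N
    proof -
      define f where "f m n = pos_part (1 - dist_int (\<theta> m - \<theta> n) / (x / real N))" for m n
      have "f m n = f n m" for m n
        using dist_int_minus[of "\<theta> m - \<theta> n"] by (simp add: f_def)
      note sum_square_symmetric[of f N, OF this]
      moreover have "f m m = 1" for m
        by (simp add: f_def dist_int_def pos_part_def)
      moreover have "(case p of (m, n) \<Rightarrow> f m n) = pos_part (x - d N p) / x" for p
        using x N by (simp add: f_def d_def pos_part_def max_def field_simps split: prod.split)
      ultimately have "R0 N x \<theta> = inverse (real N) * (real N + 2 * (\<Sum>p\<in>P N. pos_part (x - d N p) / x))"
        by (simp only: R0_def f_def[symmetric]) (simp add: P_def)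
      also have "\<dots> = 1 + 2 / x * H N x"
        using N by (simp add: H_def sum_divide_distrib[symmetric] field_simps)
      finally show ?thesis .
    qed
    have "(\<lambda>N. R0 N x \<theta>) \<longlonglongrightarrow> 1 + x \<longleftrightarrow> (\<lambda>N. H N x) \<longlonglongrightarrow> x\<^sup>2 / 2" if x: "x > 0" for x
    proof -
      \<comment> \<open>The identity fails at \<open>N = 0\<close>, where \<open>R0\<close> is 0, so
        it is used only eventually.\<close>
      have "(\<lambda>N. R0 N x \<theta>) \<longlonglongrightarrow> 1 + x \<longleftrightarrow> (\<lambda>N. 1 + 2 / x * H N x) \<longlonglongrightarrow> 1 + x"
        by (intro tendsto_cong eventually_sequentiallyI[of 1]) (rule R0[OF x])
      also have "\<dots> \<longleftrightarrow> (\<lambda>N. 2 / x * H N x) \<longlonglongrightarrow> 2 / x * (x\<^sup>2 / 2)"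
        using x by (simp add: tendsto_add_const_iff power2_eq_square)
      also have "\<dots> \<longleftrightarrow> (\<lambda>N. H N x) \<longlonglongrightarrow> x\<^sup>2 / 2"
        using x by (intro tendsto_mult_left_iff) auto
      finally show ?thesis .
    qed
    then show ?thesis by blast
  qed
  finally show ?thesis .
qed

theorem theorem3:
  fixes \<theta> :: "nat \<Rightarrow> real"
  shows
    "((\<forall>X>0. (\<lambda>N. R N X \<theta>) \<longlonglongrightarrow> X) \<longleftrightarrow> (\<forall>X>0. (\<lambda>N. R0 N X \<theta>) \<longlonglongrightarrow> 1 + X)) \<and>
     (\<forall>N\<ge>1. \<forall>X>0. R0 N X \<theta> \<ge> 1 \<and>
        (X \<le> of_int \<lceil>real N / 2\<rceil> \<longrightarrow> R0 N X \<theta> \<ge> max 1 X)) \<and>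
     (\<forall>N\<ge>1. \<forall>X>0. \<forall>Y>0. R0 N (X + Y) \<theta> \<le> R0 N X \<theta> + R0 N Y \<theta>)"
  using R_tendsto_iff_R0_tendsto[of \<theta>] R0_ge_1 R0_ge R0_subadditive by auto

end
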